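(* Let $\boldsymbol y_{E_S}=(y_{ij})_{(i,j)\in E_S}$ be the observed scores, let $$L_{FR}(\boldsymbol y_{E_S};\boldsymbol\theta,\boldsymbol\gamma):=\prod_{(i,j)\in E_S}\mathbb P(Y_{ij}=y_{ij};\boldsymbol\theta,\boldsymbol\gamma)$$ be the fully relaxed likelihood, and let the JPH-FR estimator be $(\hat{\boldsymbol\theta}_{FR},\hat{\boldsymbol\gamma}_{FR}):=\operatorname{argmax}_{(\boldsymbol\theta,\boldsymbol\gamma)\in\mathcal S_\Theta\times\mathcal S_\Gamma}L_{FR}(\boldsymbol y_{E_S};\boldsymbol\theta,\boldsymbol\gamma)$. Then $$(\hat{\boldsymbol\theta}_{FR},\hat{\boldsymbol\gamma}_{FR})=\operatorname*{argmin}_{(\boldsymbol\theta,\boldsymbol\gamma)\in\mathcal S_\Theta\times\mathcal S_\Gamma}\ \boldsymbol\phi^\top\boldsymbol g(\boldsymbol\theta,\boldsymbol\gamma)$$ (the maximizers of $L_{FR}$ are exactly the minimizers of $\boldsymbol\phi^\top\boldsymbol g$), where $\boldsymbol g:=(g_{(1)},\dots,g_{(R)})$, $\boldsymbol\phi:=(\phi^{(1)},\dots,\phi^{(R)})$, and for $h=1,\dots,R$ $$g_{(h)}(\boldsymbol\theta,\boldsymbol\gamma):=-\log\Big(\sum_{\ell,m=1}^C p_{h|\ell,m}(\boldsymbol\theta)\,p_\ell(\boldsymbol\gamma)\,p_m(\boldsymbol\gamma)\Big),\qquad \phi^{(h)}:=\sum_{i=1}^N\frac{n_i^{(h)}}{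n}.$$
   Context: Score graph: $G_S=(\{1,\dots,N\},E_S)$ is a digraph without self-loops; $(i,j)\in E_S$ means that agent $i$ evaluates agent $j$. Every node has at least one incoming edge, and $n=|E_S|$ is the number of edges. States take values in a finite set $\mathcal C=\{c_1,\dots,c_C\}$ with $C$ elements and scores in a finite set $\mathcal R=\{r_1,\dots,r_R\}$ with $R$ elements. Probabilistic model: each agent $i$ has a random state $X_i\in\mathcal C$ and each edge $(i,j)\in E_S$ has a random score $Y_{ij}\in\mathcal R$ (given by $i$ to $j$), with realization $y_{ij}$. The joint law, depending on a parameter $\boldsymbol\theta$ and a hyperparameter $\boldsymbol\gamma$, factorizes as $$\mathbb P\big((Y_{ij})_{(i,j)\in E_S},X_1,\dots,X_N\big)=\Big(\prod_{(i,j)\in E_S}\mathbb P(Y_{ij}\mid X_i,X_j)\Big)\Big(\prod_{i=1}^N\mathbb P(X_i)\Big),$$ where $\mathbb P(Y_{ij}=r_h\mid X_i=c_\ell,X_j=c_m;\boldsymbol\theta)=p_{h|\ell,m}(\boldsymbol\theta)$ for all $(i,j)\in E_S$ and $\mathbb P(X_i=c_\ell;\boldsymbol\gamma)=p_\ell(\boldsymbol\gamma)$ for all $i$, with given continuous functions $p_{h|\ell,m}$ on a set $\Theta$ and $p_\ell$ on a set $\Gamma$. The feasible sets are $\mathcal S_\Theta=\{\boldsymbol\theta\in\Theta: p_{h|\ell,m}(\boldsymbol\theta)\in[0,1],\ \sum_{h=1}^R p_{h|\ell,m}(\boldsymbol\theta)=1\ \text{for all } h,\ell,m\}$ and $\mathcal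 S_\Gamma=\{\boldsymbol\gamma\in\Gamma: p_\ell(\boldsymbol\gamma)\in[0,1]\ \text{for all }\ell,\ \sum_{\ell=1}^C p_\ell(\boldsymbol\gamma)=1\}$. $N_i^I=\{j:(j,i)\in E_S\}$ is the set of in-neighbors of $i$ and $n_i^{(h)}:=|\{j\in N_i^I: y_{ji}=r_h\}|$. The probabilities $\mathbb P(Y_{ij}=y_{ij};\boldsymbol\theta,\boldsymbol\gamma)$ are marginals of the joint law above. Conventions: $-\log 0=+\infty$ and $0\cdot(+\infty)=0$. *)

theory Defs
  imports "HOL-Probability.Probability" "Graph_Theory.Pair_Digraph"
begin

text \<open>
  An arc \<open>(i, j)\<close> means that agent \<open>i\<close> evaluates agent \<open>j\<close>.  The alphabets are
  \<open>c ` {1..C}\<close> and \<open>r ` {1..R}\<close>; \<open>p h l m \<theta>\<close> stands for $p_{h|l,m}(\theta)$ and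
  \<open>q l \<gamma>\<close> for $p_l(\gamma)$.
\<close>

definition feasible_scores ::
  "nat \<Rightarrow> nat \<Rightarrow> 'th set \<Rightarrow> (nat \<Rightarrow> nat \<Rightarrow> nat \<Rightarrow> 'th \<Rightarrow> real) \<Rightarrow> 'th set" where
  "feasible_scores C R \<Theta> p = {\<theta> \<in> \<Theta>. \<forall>l\<in>{1..C}. \<forall>m\<in>{1..C}.
     (\<forall>h\<in>{1..R}. p h l m \<theta> \<in> {0..1}) \<and> (\<Sum>h=1..R. p h l m \<theta>) = 1}"

definition feasible_states ::
  "nat \<Rightarrow> 'ga set \<Rightarrow> (nat \<Rightarrow> 'ga \<Rightarrow> real) \<Rightarrow> 'ga set" where
  "feasible_states C \<Gamma> q = {\<gamma> \<in> \<Gamma>. (\<forall>l\<in>{1..C}. q l \<gamma> \<in> {0..1}) \<and> (\<Sum>l=1..C. q l \<gamma>) = 1}"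

text \<open>
  \<open>M \<theta> \<gamma>\<close> is the probability measure for the parameters \<open>(\<theta>, \<gamma>)\<close>, \<open>X i\<close> is the state of
  agent \<open>i\<close>, and \<open>Y (i, j)\<close> is the score given by \<open>i\<close> to \<open>j\<close>.  In \<open>joint_law\<close> the factors
  are written with \<open>p\<close> and \<open>q\<close> rather than with conditional probabilities, because
  \<^const>\<open>cond_prob\<close> yields 0 on null conditioning events.
\<close>

locale score_model =
  fixes G :: "nat pair_pre_digraph"
    and N C R :: nat
    and c :: "nat \<Rightarrow> 'c" and r :: "nat \<Rightarrow> 'r"
    and \<Theta> :: "'th::topological_space set" and \<Gamma> :: "'ga::topological_space set"
    and p :: "nat \<Rightarrow> nat \<Rightarrow> nat \<Rightarrow> 'th \<Rightarrow> real" and q :: "nat \<Rightarrow> 'ga \<Rightarrow> real"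
    and M :: "'th \<Rightarrow> 'ga \<Rightarrow> 'w measure"
    and X :: "nat \<Rightarrow> 'w \<Rightarrow> 'c" and Y :: "nat \<times> nat \<Rightarrow> 'w \<Rightarrow> 'r"
  assumes graph: "pair_digraph G"
    and nodes: "pverts G = {1..N}" "1 \<le> N"
    and incoming: "\<And>i. i \<in> pverts G \<Longrightarrow> in_arcs (with_proj G) i \<noteq> {}"
    and states_distinct: "inj_on c {1..C}"
    and scores_distinct: "inj_on r {1..R}"
    and p_continuous: "\<And>h l m. h \<in> {1..R} \<Longrightarrow> l \<in> {1..C} \<Longrightarrow> m \<in> {1..C} \<Longrightarrow>
      continuous_on \<Theta> (p h l m)"
    and q_continuous: "\<And>l. l \<in> {1..C} \<Longrightarrow> continuous_on \<Gamma> (q l)"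
    and prob: "\<And>\<theta> \<gamma>. \<theta> \<in> feasible_scores C R \<Theta> p \<Longrightarrow> \<gamma> \<in> feasible_states C \<Gamma> q \<Longrightarrow>
      prob_space (M \<theta> \<gamma>)"
    and state_rv: "\<And>\<theta> \<gamma> i. \<theta> \<in> feasible_scores C R \<Theta> p \<Longrightarrow> \<gamma> \<in> feasible_states C \<Gamma> q \<Longrightarrow>
      i \<in> pverts G \<Longrightarrow> X i \<in> measurable (M \<theta> \<gamma>) (count_space (c ` {1..C}))"
    and score_rv: "\<And>\<theta> \<gamma> e. \<theta> \<in> feasible_scores C R \<Theta> p \<Longrightarrow> \<gamma> \<in> feasible_states C \<Gamma> q \<Longrightarrow>
      e \<in> parcs G \<Longrightarrow> Y e \<in> measurable (M \<theta> \<gamma>) (count_space (r ` {1..R}))"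
    and state_law: "\<And>\<theta> \<gamma> i l. \<theta> \<in> feasible_scores C R \<Theta> p \<Longrightarrow>
      \<gamma> \<in> feasible_states C \<Gamma> q \<Longrightarrow> i \<in> pverts G \<Longrightarrow> l \<in> {1..C} \<Longrightarrow>
      \<P>(\<omega> in M \<theta> \<gamma>. X i \<omega> = c l) = q l \<gamma>"
    and score_law: "\<And>\<theta> \<gamma> i j h l m. \<theta> \<in> feasible_scores C R \<Theta> p \<Longrightarrow>
      \<gamma> \<in> feasible_states C \<Gamma> q \<Longrightarrow> (i, j) \<in> parcs G \<Longrightarrow>
      h \<in> {1..R} \<Longrightarrow> l \<in> {1..C} \<Longrightarrow> m \<in> {1..C} \<Longrightarrow>
      \<P>(\<omega> in M \<theta> \<gamma>. X i \<omega> = c l \<and> X j \<omega> = c m) > 0 \<Longrightarrow>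
      \<P>(\<omega> in M \<theta> \<gamma>. Y (i, j) \<omega> = r h \<bar> X i \<omega> = c l \<and> X j \<omega> = c m) = p h l m \<theta>"
    and joint_law: "\<And>\<theta> \<gamma> s t. \<theta> \<in> feasible_scores C R \<Theta> p \<Longrightarrow>
      \<gamma> \<in> feasible_states C \<Gamma> q \<Longrightarrow>
      s \<in> pverts G \<rightarrow> {1..C} \<Longrightarrow> t \<in> parcs G \<rightarrow> {1..R} \<Longrightarrow>
      \<P>(\<omega> in M \<theta> \<gamma>. (\<forall>e\<in>parcs G. Y e \<omega> = r (t e)) \<and> (\<forall>i\<in>pverts G. X i \<omega> = c (s i)))
        = (\<Prod>(i, j)\<in>parcs G. p (t (i, j)) (s i) (s j) \<theta>) * (\<Prod>i\<in>pverts G. q (s i) \<gamma>)"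

definition in_neighbors :: "nat pair_pre_digraph \<Rightarrow> nat \<Rightarrow> nat set" where
  "in_neighbors G i = {j. (j, i) \<in> parcs G}"

definition received :: "nat pair_pre_digraph \<Rightarrow> (nat \<times> nat \<Rightarrow> 'r) \<Rightarrow> nat \<Rightarrow> 'r \<Rightarrow> nat" where
  "received G y i a = card {j \<in> in_neighbors G i. y (j, i) = a}"

definition L_FR ::
  "nat pair_pre_digraph \<Rightarrow> ('th \<Rightarrow> 'ga \<Rightarrow> 'w measure) \<Rightarrow> (nat \<times> nat \<Rightarrow> 'w \<Rightarrow> 'r) \<Rightarrow>
    (nat \<times> nat \<Rightarrow> 'r) \<Rightarrow> 'th \<times> 'ga \<Rightarrow> real" where
  "L_FR G M Y y = (\<lambda>(\<theta>, \<gamma>). \<Prod>e\<in>parcs G. \<P>(\<omega> in M \<theta> \<gamma>. Y e \<omega> = y e))"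

text \<open>Argmax and argmin are read as the sets of all maximizers and all minimizers.\<close>

definition argmax_on :: "'a set \<Rightarrow> ('a \<Rightarrow> 'b::linorder) \<Rightarrow> 'a set" where
  "argmax_on S f = {z. is_arg_max f (\<lambda>x. x \<in> S) z}"

definition argmin_on :: "'a set \<Rightarrow> ('a \<Rightarrow> 'b::linorder) \<Rightarrow> 'a set" where
  "argmin_on S f = {z. is_arg_min f (\<lambda>x. x \<in> S) z}"

definition JPH_FR ::
  "nat pair_pre_digraph \<Rightarrow> nat \<Rightarrow> nat \<Rightarrow> 'th set \<Rightarrow> 'ga set \<Rightarrow>
    (nat \<Rightarrow> nat \<Rightarrow> nat \<Rightarrow> 'th \<Rightarrow> real) \<Rightarrow> (nat \<Rightarrow> 'ga \<Rightarrow> real) \<Rightarrow>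
    ('th \<Rightarrow> 'ga \<Rightarrow> 'w measure) \<Rightarrow> (nat \<times> nat \<Rightarrow> 'w \<Rightarrow> 'r) \<Rightarrow>
    (nat \<times> nat \<Rightarrow> 'r) \<Rightarrow> ('th \<times> 'ga) set" where
  "JPH_FR G C R \<Theta> \<Gamma> p q M Y y =
     argmax_on (feasible_scores C R \<Theta> p \<times> feasible_states C \<Gamma> q) (L_FR G M Y y)"

text \<open>Used only for nonnegative arguments.\<close>

definition neg_log :: "real \<Rightarrow> ereal" where
  "neg_log x = (if x = 0 then \<infinity> else ereal (- ln x))"

definition g_FR ::
  "nat \<Rightarrow> (nat \<Rightarrow> nat \<Rightarrow> nat \<Rightarrow> 'th \<Rightarrow> real) \<Rightarrow> (nat \<Rightarrow> 'ga \<Rightarrow> real) \<Rightarrow> nat \<Rightarrow> 'th \<times> 'ga \<Rightarrow> ereal" where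
  "g_FR C p q h = (\<lambda>(\<theta>, \<gamma>). neg_log (\<Sum>l=1..C. \<Sum>m=1..C. p h l m \<theta> * q l \<gamma> * q m \<gamma>))"

definition phi_FR ::
  "nat pair_pre_digraph \<Rightarrow> (nat \<Rightarrow> 'r) \<Rightarrow> (nat \<times> nat \<Rightarrow> 'r) \<Rightarrow> nat \<Rightarrow> real" where
  "phi_FR G r y h = (\<Sum>i\<in>pverts G. real (received G y i (r h)) / real (card (parcs G)))"

end

theory Submission
  imports Defs
begin

text \<open>
  Summing the joint law over all scores but one and over all states gives
  \<open>P (Y e = r h) = (\<Sum>l m. p h l m * q l * q m)\<close> for every arc \<open>e\<close>: each factor that is summed out
  contributes 1, and the two endpoints of \<open>e\<close> differ because there are no self-loops.  Grouping
  the arcs by observed score, the objective equals \<open>- log L / n\<close>, a strictly decreasing function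
  of the likelihood.
\<close>

section \<open>Preliminaries: extended-real logarithms, sums over assignments, counting of
  arcs\<close>

lemma scaled_neg_log_strict_antimono:
  assumes "0 < a" "0 \<le> x" "x < y"
  shows "ereal a * neg_log y < ereal a * neg_log x"
  using assms by (auto simp: neg_log_def)

text \<open>On nonnegative arguments \<open>neg_log\<close> never equals minus infinity, so the sum
  is never of the form infinity minus infinity. If a factor vanishes, both sides are infinite
  because \<open>a\<close> is positive.\<close>

lemma scaled_neg_log_mult:
  assumes "0 < a" "0 \<le> x" "0 \<le> y"
  shows "ereal a * neg_log (x * y) = ereal a * neg_log x + ereal a * neg_log y"
  using assms by (auto simp: neg_log_def ln_mult algebra_simps)

lemma scaled_neg_log_prod:
  assumes "finite A" "0 < a" "\<And>i. i \<in> A \<Longrightarrow> 0 \<le> x i"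
  shows "ereal a * neg_log (\<Prod>i\<in>A. x i) = (\<Sum>i\<in>A. ereal a * neg_log (x i))"
  using assms(1,3)
proof (induction A rule: finite_induct)
  case empty
  then show ?case by (simp add: neg_log_def)
next
  case (insert i A)
  then show ?case
    using scaled_neg_log_mult[OF \<open>0 < a\<close>, of "x i" "\<Prod>i\<in>A. x i"] by (simp add: prod_nonneg)
qed

text \<open>The case \<open>k = 0\<close> is where the convention that zero times infinity is zero
  enters: a score that is never observed contributes nothing, even if its probability is
  zero.\<close>

lemma scaled_neg_log_power:
  assumes "0 < a" "0 \<le> x"
  shows "ereal a * neg_log (x ^ k) = ereal (real k * a) * neg_log x"
proof (cases "x = 0 \<or> k = 0")
  case True
  then show ?thesis using assms by (cases k) (auto simp: neg_log_def)
next
  case False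
  then show ?thesis using assms by (simp add: neg_log_def ln_realpow)
qed

text \<open>Both notions of optimum say that no feasible point is strictly better, so reversing
  strict comparisons on \<open>S\<close> suffices. Existence of an optimum is not at issue: both
  sets may be empty.\<close>

lemma argmax_on_eq_argmin_on:
  fixes f :: "'a \<Rightarrow> 'b::linorder" and g :: "'a \<Rightarrow> 'd::linorder"
  assumes "\<And>x y. x \<in> S \<Longrightarrow> y \<in> S \<Longrightarrow> f x < f y \<longleftrightarrow> g y < g x"
  shows "argmax_on S f = argmin_on S g"
  using assms by (auto simp: argmax_on_def argmin_on_def is_arg_max_def is_arg_min_def)

text \<open>The factor \<open>F (s i) (s j)\<close> couples two coordinates, so the summand is not a
  product over \<open>V\<close>. Expanding it in indicators of the values at \<open>i\<close> and
  \<open>j\<close> makes it one for each fixed pair of values; then \<open>prod_sum_PiE\<close>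
  turns the sum of products into a product of one-coordinate sums.\<close>

lemma sum_PiE_fix_two:
  fixes F :: "'b \<Rightarrow> 'b \<Rightarrow> real"
  assumes "finite V" "finite A" "i \<in> V" "j \<in> V" "i \<noteq> j" and total: "(\<Sum>a\<in>A. q a) = 1"
  shows "(\<Sum>s\<in>Pi\<^sub>E V (\<lambda>_. A). F (s i) (s j) * (\<Prod>v\<in>V. q (s v)))
    = (\<Sum>l\<in>A. \<Sum>m\<in>A. F l m * q l * q m)"
proof -
  define W where "W = V - {i, j}"
  have V: "V = insert i (insert j W)" "i \<notin> insert j W" "j \<notin> W" "finite W"
    using assms by (auto simp: W_def)
  have "(\<Sum>s\<in>Pi\<^sub>E V (\<lambda>_. A). F (s i) (s j) * (\<Prod>v\<in>V. q (s v)))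
      = (\<Sum>s\<in>Pi\<^sub>E V (\<lambda>_. A). \<Sum>l\<in>A. \<Sum>m\<in>A. F l m *
          (\<Prod>v\<in>V. q (s v) * (if v = i then of_bool (s v = l) else if v = j then of_bool (s v = m) else 1)))"
  proof (rule sum.cong[OF refl])
    fix s assume "s \<in> Pi\<^sub>E V (\<lambda>_. A)"
    then have s: "s i \<in> A" "s j \<in> A" using assms by auto
    have *: "(\<Prod>v\<in>V. q (s v) * (if v = i then of_bool (s v = l) else if v = j then of_bool (s v = m) else 1))
        = of_bool (s i = l) * (of_bool (s j = m) * (\<Prod>v\<in>V. q (s v)))" for l m
    proof -
      have "(\<Prod>v\<in>W. q (s v) * (if v = i then of_bool (s v = l) else if v = j then of_bool (s v = m) else 1))
        = (\<Prod>v\<in>W. q (s v))"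
        using V by (intro prod.cong) auto
      then show ?thesis using V \<open>i \<noteq> j\<close> by (auto simp: algebra_simps)
    qed
    show "F (s i) (s j) * (\<Prod>v\<in>V. q (s v)) = (\<Sum>l\<in>A. \<Sum>m\<in>A. F l m *
          (\<Prod>v\<in>V. q (s v) * (if v = i then of_bool (s v = l) else if v = j then of_bool (s v = m) else 1)))"
    proof -
      have "(\<Sum>l\<in>A. \<Sum>m\<in>A. F l m * (of_bool (s i = l) * (of_bool (s j = m) * (\<Prod>v\<in>V. q (s v)))))
        = (\<Sum>l\<in>A. if s i = l then (\<Sum>m\<in>A. if s j = m then F l m * (\<Prod>v\<in>V. q (s v)) else 0) else 0)"
        by (intro sum.cong refl) (auto intro!: sum.cong)
      also have "\<dots> = F (s i) (s j) * (\<Prod>v\<in>V. q (s v))"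
        using s \<open>finite A\<close> by simp
      finally show ?thesis unfolding * by simp
    qed
  qed
  \<comment> \<open>With the sum over \<open>s\<close> innermost, \<open>l\<close> and
    \<open>m\<close> are constants and \<open>F l m\<close> factors out.\<close>
  also have "\<dots> = (\<Sum>l\<in>A. \<Sum>m\<in>A. F l m * (\<Sum>s\<in>Pi\<^sub>E V (\<lambda>_. A).
          (\<Prod>v\<in>V. q (s v) * (if v = i then of_bool (s v = l) else if v = j then of_bool (s v = m) else 1))))"
    by (subst sum.swap, intro sum.cong refl, subst sum.swap) (simp add: sum_distrib_left)
  also have "\<dots> = (\<Sum>l\<in>A. \<Sum>m\<in>A. F l m * (\<Prod>v\<in>V. \<Sum>a\<in>A.
          q a * (if v = i then of_bool (a = l) else if v = j then of_bool (a = m) else 1)))"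
    using assms by (subst prod_sum_PiE) auto
  also have "\<dots> = (\<Sum>l\<in>A. \<Sum>m\<in>A. F l m * q l * q m)"
  proof (intro sum.cong refl)
    fix l m assume lm: "l \<in> A" "m \<in> A"
    \<comment> \<open>Coordinates outside \<open>i\<close> and \<open>j\<close> carry no indicator,
      so each sums to 1 by \<open>total\<close>; at \<open>i\<close> and \<open>j\<close> the
      indicator picks out one weight.\<close>
    have W1: "(\<Prod>v\<in>W. \<Sum>a\<in>A. q a * (if v = i then of_bool (a = l) else if v = j then of_bool (a = m) else 1)) = 1"
    proof (intro prod.neutral ballI)
      fix v assume "v \<in> W"
      then have "v \<noteq> i" "v \<noteq> j" using V by auto
      then show "(\<Sum>a\<in>A. q a * (if v = i then of_bool (a = l) else if v = j then of_bool (a = m) else 1)) = 1"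
        using total by simp
    qed
    have pick: "(\<Sum>a\<in>A. q a * of_bool (a = b)) = q b" if "b \<in> A" for b
    proof -
      have "(\<Sum>a\<in>A. q a * of_bool (a = b)) = (\<Sum>a\<in>A. if a = b then q a else 0)"
        by (intro sum.cong) auto
      with that \<open>finite A\<close> show ?thesis by simp
    qed
    show "F l m * (\<Prod>v\<in>V. \<Sum>a\<in>A.
          q a * (if v = i then of_bool (a = l) else if v = j then of_bool (a = m) else 1)) = F l m * q l * q m"
      using V \<open>i \<noteq> j\<close> by (simp add: W1 pick lm)
  qed
  finally show ?thesis .
qed

lemma sets_level_count_space:
  assumes "f \<in> measurable M (count_space A)"
  shows "{\<omega> \<in> space M. f \<omega> = a} \<in> sets M"
proof -
  \<comment> \<open>Intersecting with \<open>A\<close> covers values \<open>a\<close> outside the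
    alphabet, where \<open>{a}\<close> is not a measurable set of
    \<open>count_space A\<close>.\<close>
  have "{\<omega> \<in> space M. f \<omega> = a} = f -` ({a} \<inter> A) \<inter> space M"
    using measurable_space[OF assms] by auto
  then show ?thesis
    using measurable_sets[OF assms, of "{a} \<inter> A"] by simp
qed

text \<open>Partition the arcs with score \<open>a\<close> by their head. Within one fibre of
  \<open>snd\<close> an arc is determined by its tail, so \<open>fst\<close> maps the fibre over
  \<open>i\<close> bijectively onto the in-neighbours counted by \<open>received\<close>.\<close>

lemma sum_received:
  assumes "finite (parcs G)" "finite (pverts G)" "snd ` parcs G \<subseteq> pverts G"
  shows "(\<Sum>i\<in>pverts G. received G y i a) = card {e \<in> parcs G. y e = a}"
proof -
  have "{j \<in> in_neighbors G i. y (j, i) = a} = fst ` {e \<in> parcs G. y e = a \<and> snd e = i}" for i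
    by (force simp: in_neighbors_def)
  then have "received G y i a = card {e \<in> parcs G. y e = a \<and> snd e = i}" for i
    unfolding received_def by (auto intro!: card_image inj_onI prod_eqI)
  then have "(\<Sum>i\<in>pverts G. received G y i a)
      = (\<Sum>i\<in>pverts G. card {e \<in> {e \<in> parcs G. y e = a}. snd e = i})"
    by (simp add: conj_ac)
  also have "\<dots> = (\<Sum>i\<in>pverts G. \<Sum>e | e \<in> {e \<in> parcs G. y e = a} \<and> snd e = i. 1)"
    by simp
  also have "\<dots> = (\<Sum>e\<in>{e \<in> parcs G. y e = a}. 1)"
    using assms by (intro sum.group) auto
  finally show ?thesis by simp
qed

section \<open>Marginal score law and likelihood within the model\<close>

context score_model
begin

lemma finite_graph: "finite (parcs G)" "finite (pverts G)"
proof -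
  interpret pair_digraph G by (rule graph)
  show "finite (parcs G)" "finite (pverts G)" by simp_all
qed

lemma arc_endpoints:
  assumes "(i, j) \<in> parcs G"
  shows "i \<in> pverts G" "j \<in> pverts G" "i \<noteq> j"
proof -
  interpret pair_digraph G by (rule graph)
  show "i \<in> pverts G" "j \<in> pverts G" "i \<noteq> j"
    using in_arcsD1[OF assms] in_arcsD2[OF assms] no_loops'[OF assms] by auto
qed

text \<open>Vertex 1 exists and receives an arc. This makes the normalization by the number of arcs
  a strictly positive scaling.\<close>

lemma parcs_nonempty: "parcs G \<noteq> {}"
  using incoming[of 1] nodes by (auto simp: in_arcs_def)

text \<open>Summing \<open>joint_law\<close> directly treats state pairs of probability zero
  uniformly, without any conditioning.\<close>

lemma score_marginal:
  assumes \<theta>: "\<theta> \<in> feasible_scores C R \<Theta> p" and \<gamma>: "\<gamma> \<in> feasible_states C \<Gamma> q"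
    and arc: "(i, j) \<in> parcs G" and h: "h \<in> {1..R}"
  shows "\<P>(\<omega> in M \<theta> \<gamma>. Y (i, j) \<omega> = r h)
    = (\<Sum>l=1..C. \<Sum>m=1..C. p h l m \<theta> * q l \<gamma> * q m \<gamma>)"
proof -
  interpret prob_space "M \<theta> \<gamma>" using prob \<theta> \<gamma> .
  let ?E = "parcs G" and ?V = "pverts G"
  \<comment> \<open>Pinning the score of \<open>(i, j)\<close> to \<open>h\<close> inside
    \<open>B\<close> keeps the set of compatible score assignments a product, so the sum over
    \<open>T\<close> can later be factorized arc by arc.\<close>
  define B where "B e = (if e = (i, j) then {h} else {1..R})" for e :: "nat \<times> nat"
  define T where "T = Pi\<^sub>E ?E B"
  define S where "S = Pi\<^sub>E ?V (\<lambda>_. {1..C})"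
  note [simp] = finite_graph
  have BR: "B e \<subseteq> {1..R}" for e using h by (auto simp: B_def)
  have "\<P>(\<omega> in M \<theta> \<gamma>. Y (i, j) \<omega> = r h) = (\<Sum>z\<in>S \<times> T. \<P>(\<omega> in M \<theta> \<gamma>.
      (\<forall>e\<in>?E. Y e \<omega> = r (snd z e)) \<and> (\<forall>v\<in>?V. X v \<omega> = c (fst z v))))"
  \<comment> \<open>It must be shown that each outcome with score \<open>h\<close> on
    \<open>(i, j)\<close> is described by exactly one pair in \<open>S \<times> T\<close>; this
    holds at every point, hence almost everywhere.\<close>
  proof (rule prob_sum)
    show "finite (S \<times> T)"
      by (auto simp: S_def T_def B_def intro!: finite_PiE)
    show "{\<omega> \<in> space (M \<theta> \<gamma>). Y (i, j) \<omega> = r h} \<in> events"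
      using sets_level_count_space[OF score_rv[OF \<theta> \<gamma> arc]] .
    show "{\<omega> \<in> space (M \<theta> \<gamma>). (\<forall>e\<in>?E. Y e \<omega> = r (snd z e)) \<and> (\<forall>v\<in>?V. X v \<omega> = c (fst z v))} \<in> events"
      for z
      by (intro sets.sets_Collect_conj sets.sets_Collect_finite_All finite_graph
          sets_level_count_space[OF state_rv[OF \<theta> \<gamma>]]
          sets_level_count_space[OF score_rv[OF \<theta> \<gamma>]])
    show "AE \<omega> in M \<theta> \<gamma>.
       (\<forall>z\<in>S \<times> T. (\<forall>e\<in>?E. Y e \<omega> = r (snd z e)) \<and> (\<forall>v\<in>?V. X v \<omega> = c (fst z v)) \<longrightarrow>
          Y (i, j) \<omega> = r h) \<and>
       (Y (i, j) \<omega> = r h \<longrightarrow>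
          (\<exists>!z. z \<in> S \<times> T \<and> (\<forall>e\<in>?E. Y e \<omega> = r (snd z e)) \<and> (\<forall>v\<in>?V. X v \<omega> = c (fst z v))))"
    proof (intro AE_I2 conjI impI)
      fix \<omega> assume \<omega>: "\<omega> \<in> space (M \<theta> \<gamma>)"
      show "\<forall>z\<in>S \<times> T. (\<forall>e\<in>?E. Y e \<omega> = r (snd z e)) \<and> (\<forall>v\<in>?V. X v \<omega> = c (fst z v)) \<longrightarrow>
          Y (i, j) \<omega> = r h"
      proof (intro ballI impI)
        fix z assume "z \<in> S \<times> T"
          and z: "(\<forall>e\<in>?E. Y e \<omega> = r (snd z e)) \<and> (\<forall>v\<in>?V. X v \<omega> = c (fst z v))"
        then have "snd z (i, j) \<in> B (i, j)" using arc by (auto simp: T_def)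
        with z arc show "Y (i, j) \<omega> = r h" by (simp add: B_def)
      qed
      assume Yh: "Y (i, j) \<omega> = r h"
      have X_mem: "X v \<omega> \<in> c ` {1..C}" if "v \<in> ?V" for v
        using measurable_space[OF state_rv[OF \<theta> \<gamma> that] \<omega>] by simp
      have Y_mem: "Y e \<omega> \<in> r ` {1..R}" if "e \<in> ?E" for e
        using measurable_space[OF score_rv[OF \<theta> \<gamma> that] \<omega>] by simp
      \<comment> \<open>The witnesses are the indices of the realized states and scores;
        \<open>restrict\<close> makes them extensional, as membership in \<open>Pi\<^sub>E\<close>
        demands.\<close>
      define s where "s = restrict (\<lambda>v. inv_into {1..C} c (X v \<omega>)) ?V"
      define t where "t = restrict (\<lambda>e. inv_into {1..R} r (Y e \<omega>)) ?E"
      have s0: "s v \<in> {1..C}" "X v \<omega> = c (s v)" if "v \<in> ?V" for v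
        using X_mem[OF that] that inv_into_into[of "X v \<omega>" c "{1..C}"]
        by (simp_all add: s_def f_inv_into_f)
      have s: "s \<in> S"
        unfolding S_def by (rule PiE_I) (use s0(1) in \<open>simp_all add: s_def\<close>)
      have t0: "t e \<in> {1..R}" "Y e \<omega> = r (t e)" if "e \<in> ?E" for e
        using Y_mem[OF that] that inv_into_into[of "Y e \<omega>" r "{1..R}"]
        by (simp_all add: t_def f_inv_into_f)
      have "t (i, j) = h"
        using t0[OF arc] Yh h inj_onD[OF scores_distinct] by metis
      then have t: "t \<in> T"
        unfolding T_def by (intro PiE_I) (use t0(1) in \<open>auto simp: B_def\<close>, simp add: t_def)
      show "\<exists>!z. z \<in> S \<times> T \<and> (\<forall>e\<in>?E. Y e \<omega> = r (snd z e)) \<and> (\<forall>v\<in>?V. X v \<omega> = c (fst z v))"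
      proof (rule ex1I[of _ "(s, t)"])
        show "(s, t) \<in> S \<times> T \<and> (\<forall>e\<in>?E. Y e \<omega> = r (snd (s, t) e)) \<and> (\<forall>v\<in>?V. X v \<omega> = c (fst (s, t) v))"
          using s s0(2) t t0(2) by simp
        fix z assume z: "z \<in> S \<times> T \<and> (\<forall>e\<in>?E. Y e \<omega> = r (snd z e)) \<and> (\<forall>v\<in>?V. X v \<omega> = c (fst z v))"
        \<comment> \<open>Uniqueness: distinct labels determine the indices on the domain, and
          extensionality fixes the values off it.\<close>
        have "fst z = s"
        proof (rule PiE_ext)
          show zs: "fst z \<in> Pi\<^sub>E ?V (\<lambda>_. {1..C})" "s \<in> Pi\<^sub>E ?V (\<lambda>_. {1..C})"
            using z s by (auto simp: S_def)
          show "fst z v = s v" if "v \<in> ?V" for v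
            using PiE_mem[OF zs(1) that] PiE_mem[OF zs(2) that] z s0(2)[OF that] that
            by (intro inj_onD[OF states_distinct]) auto
        qed
        moreover have "snd z = t"
        proof (rule PiE_ext)
          show zt: "snd z \<in> Pi\<^sub>E ?E B" "t \<in> Pi\<^sub>E ?E B"
            using z t by (auto simp: T_def)
          show "snd z e = t e" if "e \<in> ?E" for e
            using PiE_mem[OF zt(1) that] t0[OF that] z that BR[of e]
            by (intro inj_onD[OF scores_distinct]) auto
        qed
        ultimately show "z = (s, t)" by (cases z) simp
      qed
    qed
  qed
  also have "\<dots> = (\<Sum>(s, t)\<in>S \<times> T.
      (\<Prod>e\<in>?E. p (t e) (s (fst e)) (s (snd e)) \<theta>) * (\<Prod>v\<in>?V. q (s v) \<gamma>))"
  proof (intro sum.cong refl, clarify)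
    fix s t assume st: "s \<in> S" "t \<in> T"
    have "s \<in> ?V \<rightarrow> {1..C}" using st by (auto simp: S_def)
    moreover have "t \<in> ?E \<rightarrow> {1..R}" using st BR by (fastforce simp: T_def)
    ultimately show "\<P>(\<omega> in M \<theta> \<gamma>. (\<forall>e\<in>?E. Y e \<omega> = r (snd (s, t) e)) \<and> (\<forall>v\<in>?V. X v \<omega> = c (fst (s, t) v)))
        = (\<Prod>e\<in>?E. p (t e) (s (fst e)) (s (snd e)) \<theta>) * (\<Prod>v\<in>?V. q (s v) \<gamma>)"
      using joint_law[OF \<theta> \<gamma>] by (simp add: case_prod_unfold)
  qed
  also have "\<dots> = (\<Sum>s\<in>S. (\<Sum>t\<in>T. \<Prod>e\<in>?E. p (t e) (s (fst e)) (s (snd e)) \<theta>) * (\<Prod>v\<in>?V. q (s v) \<gamma>))"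
    by (simp add: sum.cartesian_product[symmetric] sum_distrib_right)
  also have "\<dots> = (\<Sum>s\<in>S. p h (s i) (s j) \<theta> * (\<Prod>v\<in>?V. q (s v) \<gamma>))"
  proof (rule sum.cong[OF refl])
    fix s assume s: "s \<in> S"
    have s_mem: "s v \<in> {1..C}" if "v \<in> ?V" for v using s that by (auto simp: S_def)
    \<comment> \<open>Away from \<open>(i, j)\<close> the score ranges over the whole alphabet, so
      feasibility of \<open>\<theta>\<close> gives 1. This needs both endpoint states to lie in
      \<open>{1..C}\<close>.\<close>
    have rest: "(\<Sum>a\<in>B e. p a (s (fst e)) (s (snd e)) \<theta>) = 1" if "e \<in> ?E - {(i, j)}" for e
    proof -
      have "s (fst e) \<in> {1..C}" "s (snd e) \<in> {1..C}"
        using that arc_endpoints[of "fst e" "snd e"] s_mem by auto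
      then show ?thesis
        using \<theta> that by (simp add: B_def feasible_scores_def)
    qed
    have "(\<Sum>t\<in>T. \<Prod>e\<in>?E. p (t e) (s (fst e)) (s (snd e)) \<theta>)
        = (\<Prod>e\<in>?E. \<Sum>a\<in>B e. p a (s (fst e)) (s (snd e)) \<theta>)"
      unfolding T_def by (subst prod_sum_PiE) (auto simp: B_def)
    also have "\<dots> = p h (s i) (s j) \<theta>"
      using rest by (simp add: prod.remove[OF _ arc] prod.neutral) (simp add: B_def)
    finally show "(\<Sum>t\<in>T. \<Prod>e\<in>?E. p (t e) (s (fst e)) (s (snd e)) \<theta>) * (\<Prod>v\<in>?V. q (s v) \<gamma>)
        = p h (s i) (s j) \<theta> * (\<Prod>v\<in>?V. q (s v) \<gamma>)" by simp
  qed
  \<comment> \<open>The absence of self-loops supplies the two distinct coordinates required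
    here.\<close>
  also have "\<dots> = (\<Sum>l=1..C. \<Sum>m=1..C. p h l m \<theta> * q l \<gamma> * q m \<gamma>)"
    unfolding S_def using arc_endpoints[OF arc] \<gamma>
    by (intro sum_PiE_fix_two) (auto simp: feasible_states_def)
  finally show ?thesis .
qed

text \<open>By \<open>score_marginal\<close> an arc's factor in the likelihood depends only on the
  score observed on it. The likelihood is therefore a product of powers, with the score counts as
  exponents, and the scaled logarithm turns these into the weights \<open>phi_FR\<close>.\<close>

lemma objective_eq_neg_log_L_FR:
  assumes z: "z \<in> feasible_scores C R \<Theta> p \<times> feasible_states C \<Gamma> q"
    and y: "\<And>e. e \<in> parcs G \<Longrightarrow> y e \<in> r ` {1..R}"
  shows "(\<Sum>h=1..R. ereal (phi_FR G r y h) * g_FR C p q h z)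
    = ereal (1 / real (card (parcs G))) * neg_log (L_FR G M Y y z)"
proof -
  obtain \<theta> \<gamma> where z_eq: "z = (\<theta>, \<gamma>)"
    and \<theta>: "\<theta> \<in> feasible_scores C R \<Theta> p" and \<gamma>: "\<gamma> \<in> feasible_states C \<Gamma> q"
    using z by auto
  let ?n = "real (card (parcs G))"
  define A where "A h = {e \<in> parcs G. y e = r h}" for h
  define P where "P h = (\<Sum>l=1..C. \<Sum>m=1..C. p h l m \<theta> * q l \<gamma> * q m \<gamma>)" for h
  have n: "0 < ?n"
    using parcs_nonempty finite_graph by (simp add: card_gt_0_iff)
  \<comment> \<open>Summing received scores over all agents counts each arc once, at its head: the
    weight is the relative frequency of score \<open>h\<close>.\<close>
  have phi: "phi_FR G r y h = real (card (A h)) * (1 / ?n)" for h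
  proof -
    have "snd ` parcs G \<subseteq> pverts G" using arc_endpoints by auto
    then show ?thesis
      using sum_received[OF finite_graph, of y "r h"]
      by (simp add: phi_FR_def A_def sum_divide_distrib[symmetric] of_nat_sum[symmetric] del: of_nat_sum)
  qed
  have P_nonneg: "0 \<le> P h" if "h \<in> {1..R}" for h
    unfolding P_def using \<theta> \<gamma> that
    by (intro sum_nonneg mult_nonneg_nonneg) (auto simp: feasible_scores_def feasible_states_def)
  \<comment> \<open>The observed scores lie in the alphabet, so the fibres of \<open>y\<close> over
    it exhaust the arcs. Injectivity of \<open>r\<close> then allows reindexing by \<open>h\<close>
    without merging factors.\<close>
  have "L_FR G M Y y z = (\<Prod>a\<in>r ` {1..R}. \<Prod>e\<in>{e \<in> parcs G. y e = a}. \<P>(\<omega> in M \<theta> \<gamma>. Y e \<omega> = y e))"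
    unfolding z_eq L_FR_def prod.case using y finite_graph
    by (intro prod.group[symmetric]) auto
  also have "\<dots> = (\<Prod>h=1..R. \<Prod>e\<in>A h. \<P>(\<omega> in M \<theta> \<gamma>. Y e \<omega> = y e))"
    by (simp only: prod.reindex[OF scores_distinct] A_def o_def)
  also have "\<dots> = (\<Prod>h=1..R. P h ^ card (A h))"
  proof (rule prod.cong[OF refl])
    fix h assume h: "h \<in> {1..R}"
    have "\<P>(\<omega> in M \<theta> \<gamma>. Y e \<omega> = y e) = P h" if "e \<in> A h" for e
      using that score_marginal[OF \<theta> \<gamma> _ h, of "fst e" "snd e"] by (simp add: A_def P_def)
    then show "(\<Prod>e\<in>A h. \<P>(\<omega> in M \<theta> \<gamma>. Y e \<omega> = y e)) = P h ^ card (A h)"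
      by simp
  qed
  finally have "ereal (1 / ?n) * neg_log (L_FR G M Y y z)
      = (\<Sum>h=1..R. ereal (1 / ?n) * neg_log (P h ^ card (A h)))"
    using n P_nonneg by (simp only:) (rule scaled_neg_log_prod, auto)
  also have "\<dots> = (\<Sum>h=1..R. ereal (phi_FR G r y h) * g_FR C p q h z)"
    using n P_nonneg
    by (intro sum.cong refl) (simp only: scaled_neg_log_power phi g_FR_def z_eq prod.case P_def[symmetric] zero_less_divide_1_iff)
  finally show ?thesis by simp
qed

end

section \<open>Comparison of likelihood maximizers with objective minimizers\<close>

theorem mainTheorem3:
  fixes G :: "nat pair_pre_digraph"
    and N C R :: nat
    and c :: "nat \<Rightarrow> 'c" and r :: "nat \<Rightarrow> 'r"
    and \<Theta> :: "'th::topological_space set" and \<Gamma> :: "'ga::topological_space set"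
    and p :: "nat \<Rightarrow> nat \<Rightarrow> nat \<Rightarrow> 'th \<Rightarrow> real" and q :: "nat \<Rightarrow> 'ga \<Rightarrow> real"
    and M :: "'th \<Rightarrow> 'ga \<Rightarrow> 'w measure"
    and X :: "nat \<Rightarrow> 'w \<Rightarrow> 'c" and Y :: "nat \<times> nat \<Rightarrow> 'w \<Rightarrow> 'r"
    and y :: "nat \<times> nat \<Rightarrow> 'r"
  assumes "score_model G N C R c r \<Theta> \<Gamma> p q M X Y"
    and "\<And>e. e \<in> parcs G \<Longrightarrow> y e \<in> r ` {1..R}"
  shows "JPH_FR G C R \<Theta> \<Gamma> p q M Y y =
    argmin_on (feasible_scores C R \<Theta> p \<times> feasible_states C \<Gamma> q)
      (\<lambda>z. \<Sum>h=1..R. ereal (phi_FR G r y h) * g_FR C p q h z)"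
proof -
  interpret score_model G N C R c r \<Theta> \<Gamma> p q M X Y by fact
  let ?S = "feasible_scores C R \<Theta> p \<times> feasible_states C \<Gamma> q"
  have n: "0 < 1 / real (card (parcs G))"
    using parcs_nonempty finite_graph by (simp add: card_gt_0_iff)
  have L_nonneg: "0 \<le> L_FR G M Y y z" for z
    by (auto simp: L_FR_def split: prod.split intro!: prod_nonneg)
  \<comment> \<open>Strict decrease gives one implication; trichotomy on the likelihood values gives
    the converse, including comparisons with infinity.\<close>
  have antimono: "u < v \<longleftrightarrow> ereal (1 / real (card (parcs G))) * neg_log v
      < ereal (1 / real (card (parcs G))) * neg_log u" if "0 \<le> u" "0 \<le> v" for u v
  proof -
    show ?thesis
      using that scaled_neg_log_strict_antimono[OF n, of u v] scaled_neg_log_strict_antimono[OF n, of v u]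
      by (metis less_asym linorder_less_linear)
  qed
  have objective: "(\<Sum>h=1..R. ereal (phi_FR G r y h) * g_FR C p q h z)
      = ereal (1 / real (card (parcs G))) * neg_log (L_FR G M Y y z)" if "z \<in> ?S" for z
    using that assms(2) by (rule objective_eq_neg_log_L_FR)
  show ?thesis
    unfolding JPH_FR_def
  proof (rule argmax_on_eq_argmin_on)
    fix z z' assume z: "z \<in> ?S" "z' \<in> ?S"
    show "L_FR G M Y y z < L_FR G M Y y z' \<longleftrightarrow>
      (\<Sum>h=1..R. ereal (phi_FR G r y h) * g_FR C p q h z')
        < (\<Sum>h=1..R. ereal (phi_FR G r y h) * g_FR C p q h z)"
      unfolding objective[OF z(1)] objective[OF z(2)]
      by (rule antimono[OF L_nonneg L_nonneg])
  qed
qed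

end
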